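(* Consider the distributionally robust two-stage stochastic mixed-integer cone program (DR-TSS-MICP) $$\min_{y}\ c^\top y+\max_{P\in\mathcal{P}}\mathbb{E}_P[Q(y,\omega)]\quad\text{s.t. } Fy\ge a,\ y\in\mathcal{K}_1\cap\{0,1\}^n$$ under the standing assumptions stated in the context, and the decomposition branch-and-cut algorithm described in the context. Suppose there exists an integer $N$ such that after $N$ iterations of the algorithm, each second-stage problem $\mathrm{CSub}(y^k,\omega)$ with $k>N$ is solved to optimality using a branch-and-cut algorithm. Then the algorithm returns an optimal solution of (DR-TSS-MICP) after finitely many iterations.
   Context: Notation: $[r]=\{1,\dots,r\}$; $\mathbf{1}$ is the all-ones vector. Problem. $\Omega$ is a finite set of scenarios; the ambiguity set $\mathcal{P}$ is a convex set of probability distributions $p=(p_\omega)_{\omega\in\Omega}$ on $\Omega$, and $\mathbb{E}_P[Q(y,\omega)]=\sum_{\omega\in\Omega}p_\omega Q(y,\omega)$; $\mathcal{K}_1\subseteq\mathbb{R}^n$ and $\mathcal{K}_2\subseteq\mathbb{R}^{l_1+l_2}$ are convex cones. $Q(y,\omega)$ is the optimal value of the second-stage problem $\mathrm{CSub}(y,\omega)$: minimize $q^{\omega\top}x$ subject to $W^\omega x\ge r^\omega-T^\omega y$, $x_i\in[z_i^{L\omega},z_i^{U\omega}]$ for $i\in[l_1+l_2]$, $x\in\mathcal{K}_2$, $x\in\mathbb{Z}^{l_1}\times\mathbb{R}^{l_2}$. The dual cone is $\mathcal{K}_2^*=\{s\in\mathbb{R}^{l_1+l_2}:\langle s,x\rangle\ge0\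 \forall x\in\mathcal{K}_2\}$. Standing assumptions. (a) Complete recourse: for any feasible solution $y$ of the first-stage problem, all second-stage problems are feasible. (b) For any feasible first-stage solution $y$ (and any $\omega\in\Omega$) and any $x^1\in\mathbb{Z}^{l_1}$ satisfying $x^1_i\in[z_i^{L\omega},z_i^{U\omega}]$, there exists $x^2\in\mathbb{R}^{l_2}$ such that $x=[x^1;x^2]$ is strictly feasible for $\mathrm{CSub}(y,\omega)$. Branch-and-cut tree. Solving $\mathrm{CSub}(y^k,\omega)$ by the branch-and-cut method yields a set $\mathcal{L}(y^k,\omega)$ of leaf nodes. A leaf $v$ has lower and upper bound vectors $z_v^{L\omega},z_v^{U\omega}$ for $x$. The relaxation at $v$ is: minimize $q^{\omega\top}x$ subject to $W^\omega x\ge r^\omega-T^\omega y^k$, $z_v^{L\omega}\le x\le z_v^{U\omega}$, $x\in\mathcal{K}_2$. Its dual is: maximize $\gamma^\top(r^\omega-T^\omega y^k)+\tau_L^\top z_v^{L\omega}-\tau_U^\top z_v^{U\omega}$ subject to $q^\omega-s-W^{\omega\top}\gamma+\tau_U-\tau_L\in\mathcal{K}_2^*$, $\gamma,\tau_L,\tau_U\ge0$, $s\in\mathcal{K}_2^*$. With the dual variable values determined by solving the relaxation at $v$, put $R^{k\omega v}=-T^{\omega\top}\gamma$ and $S^{k\omega v}=\gamma^\top r^\omega+\tau_L^\top z_v^{L\omega}-\tau_U^\top z_v^{U\omega}$. Scenario based optimality constraint: $\eta^\omega\ge\lambda^{k\omega\top}y+\zeta^{k\omega}$, where $(\lambda^{k\omega},\zeta^{k\omega})$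 is the $(\lambda,\zeta)$-part of an optimal solution of the linear program: maximize $\lambda^\top y^k+\zeta$ over $\lambda,\zeta,\sigma_v\ge0,\gamma_v\ge0$ $(v\in\mathcal{L}(y^k,\omega))$ subject to, for all $v\in\mathcal{L}(y^k,\omega)$, $\lambda-R^{k\omega v}+F^\top\sigma_v-\gamma_v\le0$ and $\zeta-\sigma_v^\top a-S^{k\omega v}+\gamma_v^\top\mathbf{1}\le0$. Algorithm, with termination tolerance $\epsilon$. Initialize $L\gets-\infty$, $U\gets\infty$, $k\gets1$. While $U-L>\epsilon$: 1. Solve to optimality the first-stage (master) problem: minimize $c^\top y+\eta$ over $y\in\mathcal{K}_1\cap\{0,1\}^n$ with $Fy\ge a$ and $\eta\in\mathbb{R}$, subject to the aggregated optimality constraints added in iterations $1,\dots,k-1$. Let $(\eta^k,y^k)$ be the optimal solution. 2. Set $L$ to the current optimal value of the master problem, and set the current best solution $y^*\gets y^k$. 3. For each $\omega\in\Omega$: solve $\mathrm{CSub}(y^k,\omega)$ to some accuracy using the branch-and-cut method; let $x^{k\omega}$ be the best feasible solution identified; derive the scenario based optimality constraint with coefficients $(\lambda^{k\omega},\zeta^{k\omega})$. 4. Let $p^k$ be an optimal solution of $\max_{p\in\mathcal{P}}\sum_{\omega\in\Omega}p_\omega(\lambda^{k\omega\top}y^k+\zeta^{k\omega})$ (the current worst-case probability distribution), and add to the master problem the aggregated optimality constraint $\eta\ge\sum_{\omega\in\Omega}p^k_\omega(\lambda^{k\omega\top}y+\zeta^{k\omega})$. 5. Update $U\gets\min\{U,\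 c^\top y^k+\sum_{\omega\in\Omega}p^k_\omega q^{\omega\top}x^{k\omega}\}$. 6. $k\gets k+1$. After the loop, return $y^*$.
   Formalization: As stated the claim fails. Here y* is the iterate attaining U (not always y^k), U uses a worst-case distribution for the costs of x^{kω} (not p^k), and y* is shown ε-optimal, and optimal if ε is below every positive difference of objective values of feasible points. *)

theory Defs
  imports "HOL-Analysis.Analysis"
begin

section \<open>The distributionally robust two-stage problem\<close>

text \<open>
  The second-stage index set \<open>[l1 + l2]\<close> is a finite type \<open>'l\<close>; \<open>int_vars\<close> is the set of the
  \<open>l1\<close> integer coordinates, so that \<open>l1 = 0\<close> and \<open>l2 = 0\<close> are both allowed. Scenarios form a finite
  type \<open>'w\<close>, and a distribution is a vector indexed by it.
\<close>

record ('n::finite, 'f::finite, 'm::finite, 'l::finite, 'w::finite) drp =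
  cost :: "real ^ 'n"
  Fmat :: "real ^ 'n ^ 'f"
  avec :: "real ^ 'f"
  cone1 :: "(real ^ 'n) set"
  ambiguity :: "(real ^ 'w) set"
  int_vars :: "'l set"
  qvec :: "'w \<Rightarrow> real ^ 'l"
  Wmat :: "'w \<Rightarrow> real ^ 'l ^ 'm"
  Tmat :: "'w \<Rightarrow> real ^ 'n ^ 'm"
  rvec :: "'w \<Rightarrow> real ^ 'm"
  zL :: "'w \<Rightarrow> real ^ 'l"
  zU :: "'w \<Rightarrow> real ^ 'l"
  cone2 :: "(real ^ 'l) set"

definition drp_data :: "('n::finite, 'f::finite, 'm::finite, 'l::finite, 'w::finite) drp \<Rightarrow> bool" where
  "drp_data D \<longleftrightarrow>
     convex_cone (cone1 D) \<and> convex_cone (cone2 D) \<and> convex (ambiguity D) \<and>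
     (\<forall>p\<in>ambiguity D. (\<forall>\<omega>. 0 \<le> p $ \<omega>) \<and> (\<Sum>\<omega>\<in>UNIV. p $ \<omega>) = 1)"

definition first_stage_feasible ::
  "('n::finite, 'f::finite, 'm::finite, 'l::finite, 'w::finite) drp \<Rightarrow> real ^ 'n \<Rightarrow> bool" where
  "first_stage_feasible D y \<longleftrightarrow>
     avec D \<le> Fmat D *v y \<and> y \<in> cone1 D \<and> (\<forall>i. y $ i \<in> {0, 1})"

definition csub_feasible ::
  "('n::finite, 'f::finite, 'm::finite, 'l::finite, 'w::finite) drp
     \<Rightarrow> real ^ 'n \<Rightarrow> 'w \<Rightarrow> real ^ 'l \<Rightarrow> bool" where
  "csub_feasible D y \<omega> x \<longleftrightarrow>
     rvec D \<omega> - Tmat D \<omega> *v y \<le> Wmat D \<omega> *v x \<and>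
     zL D \<omega> \<le> x \<and> x \<le> zU D \<omega> \<and> x \<in> cone2 D \<and> (\<forall>i\<in>int_vars D. x $ i \<in> \<int>)"

definition csub_optimal ::
  "('n::finite, 'f::finite, 'm::finite, 'l::finite, 'w::finite) drp
     \<Rightarrow> real ^ 'n \<Rightarrow> 'w \<Rightarrow> real ^ 'l \<Rightarrow> bool" where
  "csub_optimal D y \<omega> x \<longleftrightarrow>
     csub_feasible D y \<omega> x \<and>
     (\<forall>x'. csub_feasible D y \<omega> x' \<longrightarrow> qvec D \<omega> \<bullet> x \<le> qvec D \<omega> \<bullet> x')"

text \<open>The bounds make \<open>CSub\<close> bounded below, so under complete recourse this infimum is a
  genuine one.\<close>

definition Qval ::
  "('n::finite, 'f::finite, 'm::finite, 'l::finite, 'w::finite) drp \<Rightarrow> real ^ 'n \<Rightarrow> 'w \<Rightarrow> real" where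
  "Qval D y \<omega> = Inf {qvec D \<omega> \<bullet> x | x. csub_feasible D y \<omega> x}"

text \<open>\<open>max\<^sub>P E\<^sub>P[v]\<close>; the supremum is finite since distributions are bounded, and it is the
  maximum whenever the latter is attained.\<close>

definition worst_case ::
  "('n::finite, 'f::finite, 'm::finite, 'l::finite, 'w::finite) drp \<Rightarrow> ('w \<Rightarrow> real) \<Rightarrow> real" where
  "worst_case D v = (SUP p\<in>ambiguity D. \<Sum>\<omega>\<in>UNIV. p $ \<omega> * v \<omega>)"

definition objective ::
  "('n::finite, 'f::finite, 'm::finite, 'l::finite, 'w::finite) drp \<Rightarrow> real ^ 'n \<Rightarrow> real" where
  "objective D y = cost D \<bullet> y + worst_case D (Qval D y)"

definition drp_optimal ::
  "('n::finite, 'f::finite, 'm::finite, 'l::finite, 'w::finite) drp \<Rightarrow> real ^ 'n \<Rightarrow> bool" where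
  "drp_optimal D y \<longleftrightarrow>
     first_stage_feasible D y \<and>
     (\<forall>y'. first_stage_feasible D y' \<longrightarrow> objective D y \<le> objective D y')"

definition complete_recourse ::
  "('n::finite, 'f::finite, 'm::finite, 'l::finite, 'w::finite) drp \<Rightarrow> bool" where
  "complete_recourse D \<longleftrightarrow>
     (\<forall>y \<omega>. first_stage_feasible D y \<longrightarrow> (\<exists>x. csub_feasible D y \<omega> x))"

text \<open>Slater point in the conic sense: feasible and interior to the cone. The linear inequalities
  need not be strict; for the bounds on the integer coordinates they could not be, because the
  recourse assumption below prescribes these coordinates, possibly at a bound.\<close>

definition csub_strictly_feasible ::
  "('n::finite, 'f::finite, 'm::finite, 'l::finite, 'w::finite) drp
     \<Rightarrow> real ^ 'n \<Rightarrow> 'w \<Rightarrow> real ^ 'l \<Rightarrow> bool" where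
  "csub_strictly_feasible D y \<omega> x \<longleftrightarrow> csub_feasible D y \<omega> x \<and> x \<in> interior (cone2 D)"

text \<open>Only the integer coordinates of \<open>x1\<close> matter.\<close>

definition strict_recourse ::
  "('n::finite, 'f::finite, 'm::finite, 'l::finite, 'w::finite) drp \<Rightarrow> bool" where
  "strict_recourse D \<longleftrightarrow>
     (\<forall>y \<omega> (x1 :: real ^ 'l).
        first_stage_feasible D y \<and>
        (\<forall>i\<in>int_vars D. x1 $ i \<in> \<int> \<and> zL D \<omega> $ i \<le> x1 $ i \<and> x1 $ i \<le> zU D \<omega> $ i) \<longrightarrow>
        (\<exists>x. (\<forall>i\<in>int_vars D. x $ i = x1 $ i) \<and> csub_strictly_feasible D y \<omega> x))"


section \<open>Branch and cut for the second stage\<close>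

type_synonym 'l node = "(real ^ 'l) \<times> (real ^ 'l)"  \<comment> \<open>lower and upper bound vectors\<close>

definition node_feasible ::
  "('n::finite, 'f::finite, 'm::finite, 'l::finite, 'w::finite) drp
     \<Rightarrow> real ^ 'n \<Rightarrow> 'w \<Rightarrow> 'l node \<Rightarrow> real ^ 'l \<Rightarrow> bool" where
  "node_feasible D y \<omega> v x \<longleftrightarrow>
     rvec D \<omega> - Tmat D \<omega> *v y \<le> Wmat D \<omega> *v x \<and> fst v \<le> x \<and> x \<le> snd v \<and> x \<in> cone2 D"

text \<open>
  Leaf sets of the trees obtainable for \<open>CSub(y, \<omega>)\<close>. Branching on an integer coordinate \<open>i\<close> at a
  value strictly between the integers \<open>t\<close> and \<open>t + 1\<close> creates the children \<open>x\<^sub>i \<le> t\<close> and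
  \<open>x\<^sub>i \<ge> t + 1\<close>. A node with infeasible relaxation is discarded: its dual has no optimal solution,
  so it cannot contribute coefficients to a cut.
\<close>

inductive bc_leaves ::
  "('n::finite, 'f::finite, 'm::finite, 'l::finite, 'w::finite) drp
     \<Rightarrow> real ^ 'n \<Rightarrow> 'w \<Rightarrow> 'l node set \<Rightarrow> bool"
  for D :: "('n, 'f, 'm, 'l, 'w) drp" and y :: "real ^ 'n" and \<omega> :: 'w where
  root: "bc_leaves D y \<omega> {(zL D \<omega>, zU D \<omega>)}"
| branch: "bc_leaves D y \<omega> V \<Longrightarrow> (l, u) \<in> V \<Longrightarrow> i \<in> int_vars D \<Longrightarrow>
     l $ i < of_int t + 1 \<Longrightarrow> of_int t < u $ i \<Longrightarrow>
     bc_leaves D y \<omega>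
       ((V - {(l, u)}) \<union> {(l, \<chi> j. if j = i then of_int t else u $ j),
                         (\<chi> j. if j = i then of_int t + 1 else l $ j, u)})"
| discard: "bc_leaves D y \<omega> V \<Longrightarrow> v \<in> V \<Longrightarrow> \<not> (\<exists>x. node_feasible D y \<omega> v x) \<Longrightarrow>
     bc_leaves D y \<omega> (V - {v})"

definition dual_cone :: "'a::real_inner set \<Rightarrow> 'a set" where
  "dual_cone K = {s. \<forall>x\<in>K. 0 \<le> s \<bullet> x}"

record ('m::finite, 'l::finite) node_dual =
  gam :: "real ^ 'm"
  tauL :: "real ^ 'l"
  tauU :: "real ^ 'l"
  slk :: "real ^ 'l"

definition dual_feasible ::
  "('n::finite, 'f::finite, 'm::finite, 'l::finite, 'w::finite) drp
     \<Rightarrow> 'w \<Rightarrow> ('m, 'l) node_dual \<Rightarrow> bool" where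
  "dual_feasible D \<omega> d \<longleftrightarrow>
     qvec D \<omega> - slk d - transpose (Wmat D \<omega>) *v gam d + tauU d - tauL d \<in> dual_cone (cone2 D) \<and>
     0 \<le> gam d \<and> 0 \<le> tauL d \<and> 0 \<le> tauU d \<and> slk d \<in> dual_cone (cone2 D)"

definition dual_value ::
  "('n::finite, 'f::finite, 'm::finite, 'l::finite, 'w::finite) drp
     \<Rightarrow> real ^ 'n \<Rightarrow> 'w \<Rightarrow> 'l node \<Rightarrow> ('m, 'l) node_dual \<Rightarrow> real" where
  "dual_value D y \<omega> v d =
     gam d \<bullet> (rvec D \<omega> - Tmat D \<omega> *v y) + tauL d \<bullet> fst v - tauU d \<bullet> snd v"

definition dual_optimal ::
  "('n::finite, 'f::finite, 'm::finite, 'l::finite, 'w::finite) drp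
     \<Rightarrow> real ^ 'n \<Rightarrow> 'w \<Rightarrow> 'l node \<Rightarrow> ('m, 'l) node_dual \<Rightarrow> bool" where
  "dual_optimal D y \<omega> v d \<longleftrightarrow>
     dual_feasible D \<omega> d \<and>
     (\<forall>d' :: ('m, 'l) node_dual. dual_feasible D \<omega> d' \<longrightarrow>
        dual_value D y \<omega> v d' \<le> dual_value D y \<omega> v d)"

definition Rcoef ::
  "('n::finite, 'f::finite, 'm::finite, 'l::finite, 'w::finite) drp
     \<Rightarrow> 'w \<Rightarrow> ('m, 'l) node_dual \<Rightarrow> real ^ 'n" where
  "Rcoef D \<omega> d = - (transpose (Tmat D \<omega>) *v gam d)"

definition Scoef ::
  "('n::finite, 'f::finite, 'm::finite, 'l::finite, 'w::finite) drp
     \<Rightarrow> 'w \<Rightarrow> 'l node \<Rightarrow> ('m, 'l) node_dual \<Rightarrow> real" where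
  "Scoef D \<omega> v d = gam d \<bullet> rvec D \<omega> + tauL d \<bullet> fst v - tauU d \<bullet> snd v"

text \<open>Branch and cut has solved \<open>CSub(y, \<omega>)\<close> to optimality: the best solution found is optimal, and
  every leaf is fathomed, i.e. its relaxation bound does not lie below the incumbent value. The
  relaxation bound is expressed without assuming that the relaxation attains its minimum.\<close>

definition solved_to_optimality ::
  "('n::finite, 'f::finite, 'm::finite, 'l::finite, 'w::finite) drp
     \<Rightarrow> real ^ 'n \<Rightarrow> 'w \<Rightarrow> 'l node set \<Rightarrow> real ^ 'l \<Rightarrow> bool" where
  "solved_to_optimality D y \<omega> V x \<longleftrightarrow>
     csub_optimal D y \<omega> x \<and>
     (\<forall>v\<in>V. \<forall>x'. node_feasible D y \<omega> v x' \<longrightarrow> qvec D \<omega> \<bullet> x \<le> qvec D \<omega> \<bullet> x')"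


section \<open>Scenario based optimality constraints\<close>

definition cut_lp_feasible ::
  "('n::finite, 'f::finite, 'm::finite, 'l::finite, 'w::finite) drp
     \<Rightarrow> 'w \<Rightarrow> 'l node set \<Rightarrow> ('l node \<Rightarrow> ('m, 'l) node_dual)
     \<Rightarrow> real ^ 'n \<Rightarrow> real \<Rightarrow> ('l node \<Rightarrow> real ^ 'f) \<Rightarrow> ('l node \<Rightarrow> real ^ 'n) \<Rightarrow> bool" where
  "cut_lp_feasible D \<omega> V d lam zet \<sigma> \<gamma> \<longleftrightarrow>
     (\<forall>v\<in>V. 0 \<le> \<sigma> v \<and> 0 \<le> \<gamma> v \<and>
        lam - Rcoef D \<omega> (d v) + transpose (Fmat D) *v \<sigma> v - \<gamma> v \<le> 0 \<and>
        zet - \<sigma> v \<bullet> avec D - Scoef D \<omega> v (d v) + \<gamma> v \<bullet> 1 \<le> 0)"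

definition cut_lp_optimal ::
  "('n::finite, 'f::finite, 'm::finite, 'l::finite, 'w::finite) drp
     \<Rightarrow> real ^ 'n \<Rightarrow> 'w \<Rightarrow> 'l node set \<Rightarrow> ('l node \<Rightarrow> ('m, 'l) node_dual)
     \<Rightarrow> real ^ 'n \<Rightarrow> real \<Rightarrow> bool" where
  "cut_lp_optimal D y \<omega> V d lam zet \<longleftrightarrow>
     (\<exists>\<sigma> \<gamma>. cut_lp_feasible D \<omega> V d lam zet \<sigma> \<gamma>) \<and>
     (\<forall>lam' zet' \<sigma>' \<gamma>'. cut_lp_feasible D \<omega> V d lam' zet' \<sigma>' \<gamma>' \<longrightarrow>
        lam' \<bullet> y + zet' \<le> lam \<bullet> y + zet)"


section \<open>The decomposition branch-and-cut algorithm\<close>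

text \<open>The choices made during a run, indexed by the iteration number \<open>k \<ge> 1\<close>. Entries belonging to
  iterations that are not executed are irrelevant.\<close>

record ('n::finite, 'm::finite, 'l::finite, 'w::finite) run =
  it_y :: "nat \<Rightarrow> real ^ 'n"
  it_eta :: "nat \<Rightarrow> real"
  it_leaves :: "nat \<Rightarrow> 'w \<Rightarrow> 'l node set"
  it_dual :: "nat \<Rightarrow> 'w \<Rightarrow> 'l node \<Rightarrow> ('m, 'l) node_dual"
  it_x :: "nat \<Rightarrow> 'w \<Rightarrow> real ^ 'l"
  it_lam :: "nat \<Rightarrow> 'w \<Rightarrow> real ^ 'n"
  it_zeta :: "nat \<Rightarrow> 'w \<Rightarrow> real"
  it_p :: "nat \<Rightarrow> real ^ 'w"

definition master_feasible ::
  "('n::finite, 'f::finite, 'm::finite, 'l::finite, 'w::finite) drp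
     \<Rightarrow> ('n, 'm, 'l, 'w) run \<Rightarrow> nat \<Rightarrow> real ^ 'n \<Rightarrow> real \<Rightarrow> bool" where
  "master_feasible D A k y \<eta> \<longleftrightarrow>
     first_stage_feasible D y \<and>
     (\<forall>j\<in>{1..<k}. \<eta> \<ge> (\<Sum>\<omega>\<in>UNIV. it_p A j $ \<omega> * (it_lam A j \<omega> \<bullet> y + it_zeta A j \<omega>)))"

definition master_value ::
  "('n::finite, 'f::finite, 'm::finite, 'l::finite, 'w::finite) drp
     \<Rightarrow> ('n, 'm, 'l, 'w) run \<Rightarrow> nat \<Rightarrow> ereal" where
  "master_value D A k = Inf {ereal (cost D \<bullet> y + \<eta>) | y \<eta>. master_feasible D A k y \<eta>}"

text \<open>In the first iteration there are no cuts and the free variable \<open>\<eta>\<close> makes the master problem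
  unbounded; any feasible point is then accepted, and \<open>L\<close> stays \<open>-\<infinity>\<close>.\<close>

definition master_solution ::
  "('n::finite, 'f::finite, 'm::finite, 'l::finite, 'w::finite) drp
     \<Rightarrow> ('n, 'm, 'l, 'w) run \<Rightarrow> nat \<Rightarrow> real ^ 'n \<Rightarrow> real \<Rightarrow> bool" where
  "master_solution D A k y \<eta> \<longleftrightarrow>
     master_feasible D A k y \<eta> \<and>
     (master_value D A k = -\<infinity> \<or> ereal (cost D \<bullet> y + \<eta>) = master_value D A k)"

text \<open>\<open>lower D A k\<close>, \<open>upper D A k\<close>, \<open>best D A k\<close> are \<open>L\<close>, \<open>U\<close>, \<open>y*\<close> after \<open>k\<close> iterations.\<close>

definition lower ::
  "('n::finite, 'f::finite, 'm::finite, 'l::finite, 'w::finite) drp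
     \<Rightarrow> ('n, 'm, 'l, 'w) run \<Rightarrow> nat \<Rightarrow> ereal" where
  "lower D A k = (if k = 0 then -\<infinity> else master_value D A k)"

text \<open>
  The upper bound found in iteration \<open>k\<close>. It is taken with respect to a worst-case distribution for
  the second-stage costs \<open>q\<^sup>\<omega> \<bullet> x\<^sup>k\<^sup>\<omega>\<close>. Once the subproblems are solved to optimality, these costs equal
  the cut values \<open>\<lambda>\<^sup>k\<^sup>\<omega> \<bullet> y\<^sup>k + \<zeta>\<^sup>k\<^sup>\<omega>\<close> and \<open>p\<^sup>k\<close> is such a distribution. For subproblems solved
  inexactly, however, \<open>\<Sum>\<^sub>\<omega> p\<^sup>k\<^sub>\<omega> (q\<^sup>\<omega> \<bullet> x\<^sup>k\<^sup>\<omega>)\<close> can lie below the optimal value of the whole problem.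
\<close>

definition upper_candidate ::
  "('n::finite, 'f::finite, 'm::finite, 'l::finite, 'w::finite) drp
     \<Rightarrow> ('n, 'm, 'l, 'w) run \<Rightarrow> nat \<Rightarrow> real" where
  "upper_candidate D A k =
     cost D \<bullet> it_y A k + worst_case D (\<lambda>\<omega>. qvec D \<omega> \<bullet> it_x A k \<omega>)"

primrec upper ::
  "('n::finite, 'f::finite, 'm::finite, 'l::finite, 'w::finite) drp
     \<Rightarrow> ('n, 'm, 'l, 'w) run \<Rightarrow> nat \<Rightarrow> ereal" where
  "upper D A 0 = \<infinity>"
| "upper D A (Suc k) = min (upper D A k) (ereal (upper_candidate D A (Suc k)))"

text \<open>The current best solution is the iterate attaining \<open>U\<close>, the later one in case of ties. Taking
  \<open>y\<^sup>k\<close> unconditionally would be wrong: the loop may stop at an iterate that ties in the master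
  problem only because its own cut has not been added yet. The initial value is always
  overwritten in the first iteration, as \<open>U\<close> starts at infinity.\<close>

primrec best ::
  "('n::finite, 'f::finite, 'm::finite, 'l::finite, 'w::finite) drp
     \<Rightarrow> ('n, 'm, 'l, 'w) run \<Rightarrow> nat \<Rightarrow> real ^ 'n" where
  "best D A 0 = undefined"
| "best D A (Suc k) =
     (if ereal (upper_candidate D A (Suc k)) \<le> upper D A k then it_y A (Suc k) else best D A k)"

definition iteration ::
  "('n::finite, 'f::finite, 'm::finite, 'l::finite, 'w::finite) drp
     \<Rightarrow> ('n, 'm, 'l, 'w) run \<Rightarrow> nat \<Rightarrow> bool" where
  "iteration D A k \<longleftrightarrow>
     master_solution D A k (it_y A k) (it_eta A k) \<and>
     (\<forall>\<omega>. bc_leaves D (it_y A k) \<omega> (it_leaves A k \<omega>) \<and>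
          (\<forall>v\<in>it_leaves A k \<omega>. dual_optimal D (it_y A k) \<omega> v (it_dual A k \<omega> v)) \<and>
          csub_feasible D (it_y A k) \<omega> (it_x A k \<omega>) \<and>
          cut_lp_optimal D (it_y A k) \<omega> (it_leaves A k \<omega>) (it_dual A k \<omega>)
            (it_lam A k \<omega>) (it_zeta A k \<omega>)) \<and>
     it_p A k \<in> ambiguity D \<and>
     (\<forall>p\<in>ambiguity D.
        (\<Sum>\<omega>\<in>UNIV. p $ \<omega> * (it_lam A k \<omega> \<bullet> it_y A k + it_zeta A k \<omega>))
          \<le> (\<Sum>\<omega>\<in>UNIV. it_p A k $ \<omega> * (it_lam A k \<omega> \<bullet> it_y A k + it_zeta A k \<omega>)))"

text \<open>Iteration \<open>k\<close> is executed iff the loop test succeeded after each of the iterations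
  \<open>0, \<dots>, k - 1\<close> (with \<open>0\<close> standing for the initialization).\<close>

definition executed ::
  "('n::finite, 'f::finite, 'm::finite, 'l::finite, 'w::finite) drp
     \<Rightarrow> ('n, 'm, 'l, 'w) run \<Rightarrow> real \<Rightarrow> nat \<Rightarrow> bool" where
  "executed D A \<epsilon> k \<longleftrightarrow> 1 \<le> k \<and> (\<forall>j<k. upper D A j - lower D A j > ereal \<epsilon>)"

definition algorithm_run ::
  "('n::finite, 'f::finite, 'm::finite, 'l::finite, 'w::finite) drp
     \<Rightarrow> ('n, 'm, 'l, 'w) run \<Rightarrow> real \<Rightarrow> bool" where
  "algorithm_run D A \<epsilon> \<longleftrightarrow> (\<forall>k. executed D A \<epsilon> k \<longrightarrow> iteration D A k)"

definition returns_after ::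
  "('n::finite, 'f::finite, 'm::finite, 'l::finite, 'w::finite) drp
     \<Rightarrow> ('n, 'm, 'l, 'w) run \<Rightarrow> real \<Rightarrow> nat \<Rightarrow> real ^ 'n \<Rightarrow> bool" where
  "returns_after D A \<epsilon> K y \<longleftrightarrow>
     executed D A \<epsilon> K \<and> \<not> (upper D A K - lower D A K > ereal \<epsilon>) \<and> y = best D A K"

end

theory Submission
  imports Defs
begin

text \<open>
  A scenario cut is the best affine function below all leaf functions
  \<open>y \<mapsto> R\<^sub>v \<bullet> y + S\<^sub>v\<close>, certified on \<open>F y \<ge> a\<close>, \<open>0 \<le> y \<le> 1\<close>. By weak duality and strict recourse it
  stays below \<open>Q(\<cdot>, \<omega>)\<close> at every first-stage point, so the master value is a lower bound. If the
  subproblem was solved to optimality, conic strong duality at the leaves makes it exact at \<open>y\<^sup>k\<close>.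
  There are finitely many binary \<open>y\<close>, hence an iterate \<open>y\<^sup>j\<close> solved exactly is eventually revisited;
  its exact cut then forces the lower bound up to the upper bound recorded at iteration \<open>j\<close>.
\<close>

section \<open>Conic duality\<close>

lemma convex_cone_hull_finite_image:
  fixes f :: "'i \<Rightarrow> 'a::real_vector"
  assumes "finite I" and "x \<in> convex_cone hull (f ` I)"
  obtains \<mu> where "\<forall>i\<in>I. 0 \<le> \<mu> i" and "x = (\<Sum>i\<in>I. \<mu> i *\<^sub>R f i)"
proof -
  define C where "C = {\<Sum>i\<in>I. \<mu> i *\<^sub>R f i | \<mu>. \<forall>i\<in>I. 0 \<le> (\<mu> i :: real)}"
  have "f j \<in> C" if "j \<in> I" for j
  proof -
    have "f j = (\<Sum>i\<in>I. (if i = j then 1 else 0) *\<^sub>R f i)"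
      using that assms(1) by (simp add: if_distrib [of "\<lambda>t. t *\<^sub>R _"] cong: if_cong)
    then show ?thesis
      unfolding C_def by (intro CollectI exI [of _ "\<lambda>i. if i = j then 1 else 0"]) auto
  qed
  moreover have "convex_cone C"
    unfolding convex_cone_iff
  proof (intro conjI ballI allI impI)
    show "0 \<in> C"
      unfolding C_def by (intro CollectI exI [of _ "\<lambda>_. 0"]) auto
  next
    fix x y assume "x \<in> C" "y \<in> C"
    then obtain \<mu> \<nu> where "\<forall>i\<in>I. 0 \<le> \<mu> i" "x = (\<Sum>i\<in>I. \<mu> i *\<^sub>R f i)"
      and "\<forall>i\<in>I. 0 \<le> \<nu> i" "y = (\<Sum>i\<in>I. \<nu> i *\<^sub>R f i)"
      unfolding C_def by blast
    then show "x + y \<in> C"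
      unfolding C_def
      by (intro CollectI exI [of _ "\<lambda>i. \<mu> i + \<nu> i"]) (auto simp: sum.distrib scaleR_add_left)
  next
    fix x and c :: real assume "x \<in> C" "0 \<le> c"
    then obtain \<mu> where "\<forall>i\<in>I. 0 \<le> \<mu> i" "x = (\<Sum>i\<in>I. \<mu> i *\<^sub>R f i)"
      unfolding C_def by blast
    with \<open>0 \<le> c\<close> show "c *\<^sub>R x \<in> C"
      unfolding C_def by (intro CollectI exI [of _ "\<lambda>i. c * \<mu> i"]) (auto simp: scaleR_sum_right)
  qed
  ultimately have "convex_cone hull (f ` I) \<subseteq> C"
    by (intro hull_minimal) auto
  with assms(2) that show ?thesis
    unfolding C_def by blast
qed

text \<open>Each inequality becomes a pair (normal vector, right-hand side). An implied inequality
  must lie in the closed cone these pairs generate; otherwise a separating functional yields a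
  point, or a recession direction from \<open>x0\<close>, that violates the implication.\<close>

lemma affine_farkas:
  fixes G :: "'i \<Rightarrow> 'a::euclidean_space"
  assumes "finite I"
    and x0: "\<forall>i\<in>I. h i \<le> G i \<bullet> x0"
    and implied: "\<And>x. \<forall>i\<in>I. h i \<le> G i \<bullet> x \<Longrightarrow> f \<le> e \<bullet> x"
  obtains \<mu> where "\<forall>i\<in>I. 0 \<le> \<mu> i" and "e = (\<Sum>i\<in>I. \<mu> i *\<^sub>R G i)"
    and "f \<le> (\<Sum>i\<in>I. \<mu> i * h i)"
proof -
  \<comment> \<open>The extra generator \<open>(0, - 1)\<close> allows a right-hand side to be
    lowered, which is why the conclusion bounds \<open>f\<close> only from above.\<close>
  define F where "F = (\<lambda>k. case k of None \<Rightarrow> (0, - 1) | Some i \<Rightarrow> (G i, h i))"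
  define J where "J = insert None (Some ` I)"
  have "finite J" unfolding J_def using assms(1) by simp
  define C where "C = convex_cone hull (F ` J)"
  have cone: "convex_cone C" unfolding C_def by (rule convex_cone_convex_cone_hull)
  have gen: "F k \<in> C" if "k \<in> J" for k
    unfolding C_def using that by (intro hull_inc) simp
  have "(e, f) \<in> C"
  proof (rule ccontr)
    assume "(e, f) \<notin> C"
    have "closed C"
      unfolding C_def using \<open>finite J\<close> by (intro closed_convex_cone_hull) simp
    have "convex C" using cone by (simp add: convex_cone_def)
    obtain a \<beta> where a: "a \<bullet> (e, f) < \<beta>" "\<And>z. z \<in> C \<Longrightarrow> \<beta> < a \<bullet> z"
      using separating_hyperplane_closed_point [OF \<open>convex C\<close> \<open>closed C\<close> \<open>(e, f) \<notin> C\<close>] by blast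
    have "\<beta> < 0" using a(2) [OF convex_cone_contains_0 [OF cone]] by simp
    have nonneg: "0 \<le> a \<bullet> z" if "z \<in> C" for z
    proof (rule ccontr)
      assume neg: "\<not> 0 \<le> a \<bullet> z"
      \<comment> \<open>Scaling by \<open>t\<close> gives the functional the value \<beta> exactly,
        which the strict separation forbids on \<open>C\<close>.\<close>
      define t where "t = \<beta> / (a \<bullet> z)"
      have "t *\<^sub>R z \<in> C"
        using neg \<open>\<beta> < 0\<close> that cone
        by (intro convex_cone_scaleR) (auto simp: t_def divide_nonpos_nonpos)
      from a(2) [OF this] show False using neg by (simp add: t_def)
    qed
    obtain x s where as: "a = (x, s)" by (cases a)
    have s: "s \<le> 0" using nonneg [OF gen [of None]] by (simp add: as F_def J_def)
    have ineq: "0 \<le> G i \<bullet> x + s * h i" if "i \<in> I" for i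
      using nonneg [OF gen [of "Some i"]] that by (simp add: as F_def J_def inner_commute)
    have obj: "e \<bullet> x + s * f < 0"
      using a(1) \<open>\<beta> < 0\<close> by (simp add: as inner_commute mult.commute)
    show False
    proof (cases "s = 0")
      case True
      \<comment> \<open>Now \<open>x\<close> is a recession direction along which \<open>e\<close>
        decreases; this \<open>t\<close> is long enough to push \<open>e\<close> below
        \<open>f\<close>.\<close>
      define t where "t = (\<bar>e \<bullet> x0 - f\<bar> + 1) / - (e \<bullet> x)"
      have neg: "e \<bullet> x < 0" using obj True by simp
      then have "0 \<le> t" unfolding t_def by (intro divide_nonneg_pos) auto
      then have "f \<le> e \<bullet> (x0 + t *\<^sub>R x)"
        using x0 ineq True by (intro implied) (auto simp: inner_add_right intro!: add_increasing2)
      also have "\<dots> = e \<bullet> x0 - (\<bar>e \<bullet> x0 - f\<bar> + 1)"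
        using neg by (simp add: inner_diff_right t_def)
      finally show False by linarith
    next
      case False
      with s have s: "s < 0" by simp
      \<comment> \<open>For negative \<open>s\<close>, rescaling \<open>x\<close> turns the
        homogeneous inequalities into the original ones.\<close>
      have "h i \<le> G i \<bullet> ((- 1 / s) *\<^sub>R x)" if "i \<in> I" for i
        using s ineq [OF that] by (simp add: field_simps)
      then have "f \<le> e \<bullet> ((- 1 / s) *\<^sub>R x)"
        by (intro implied) blast
      then show False using s obj by (simp add: field_simps)
    qed
  qed
  then obtain \<nu> where \<nu>: "\<forall>k\<in>J. 0 \<le> \<nu> k" "(e, f) = (\<Sum>k\<in>J. \<nu> k *\<^sub>R F k)"
    unfolding C_def using convex_cone_hull_finite_image [OF \<open>finite J\<close>] by metis
  have "(e, f) = \<nu> None *\<^sub>R (0, - 1) + (\<Sum>i\<in>I. \<nu> (Some i) *\<^sub>R (G i, h i))"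
    using \<nu>(2) assms(1) by (simp add: J_def F_def sum.reindex)
  then have "e = (\<Sum>i\<in>I. \<nu> (Some i) *\<^sub>R G i)" "f = - \<nu> None + (\<Sum>i\<in>I. \<nu> (Some i) * h i)"
    by (simp_all add: prod_eq_iff fst_sum snd_sum)
  moreover have "0 \<le> \<nu> None" "\<forall>i\<in>I. 0 \<le> \<nu> (Some i)"
    using \<nu>(1) by (simp_all add: J_def)
  ultimately show ?thesis by (intro that [of "\<lambda>i. \<nu> (Some i)"]) auto
qed

lemma sum_UNIV_sum_type:
  fixes f :: "'a::finite + 'b::finite \<Rightarrow> 'c::comm_monoid_add"
  shows "(\<Sum>k\<in>UNIV. f k) = (\<Sum>i\<in>UNIV. f (Inl i)) + (\<Sum>j\<in>UNIV. f (Inr j))"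
  by (simp flip: UNIV_Plus_UNIV add: sum.Plus)

text \<open>The additional inequality \<open>h \<le> g \<bullet> x\<close> is a slot for a bound on
  the objective; its multiplier \<theta> is what the duality proof divides by.\<close>

lemma box_farkas:
  fixes W :: "real ^ 'l ^ 'm"
  assumes x0: "b \<le> W *v x0" "l \<le> x0" "x0 \<le> u" "h \<le> g \<bullet> x0"
    and implied: "\<And>x. b \<le> W *v x \<Longrightarrow> l \<le> x \<Longrightarrow> x \<le> u \<Longrightarrow> h \<le> g \<bullet> x \<Longrightarrow> f \<le> e \<bullet> x"
  obtains \<gamma> \<tau>L \<tau>U :: "real ^ _" and \<theta> :: real
  where "0 \<le> \<gamma>" "0 \<le> \<tau>L" "0 \<le> \<tau>U" "0 \<le> \<theta>"
    and "\<And>x. e \<bullet> x = \<gamma> \<bullet> (W *v x) + \<tau>L \<bullet> x - \<tau>U \<bullet> x + \<theta> * (g \<bullet> x)"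
    and "f \<le> \<gamma> \<bullet> b + \<tau>L \<bullet> l - \<tau>U \<bullet> u + \<theta> * h"
proof -
  define G :: "'m + 'l + 'l + unit \<Rightarrow> real ^ 'l" where
    "G = case_sum (\<lambda>i. W $ i) (case_sum (\<lambda>j. axis j 1) (case_sum (\<lambda>j. - axis j 1) (\<lambda>_. g)))"
  define r :: "'m + 'l + 'l + unit \<Rightarrow> real" where
    "r = case_sum (\<lambda>i. b $ i) (case_sum (\<lambda>j. l $ j) (case_sum (\<lambda>j. - u $ j) (\<lambda>_. h)))"
  have iff: "(\<forall>k\<in>UNIV. r k \<le> G k \<bullet> x) \<longleftrightarrow> b \<le> W *v x \<and> l \<le> x \<and> x \<le> u \<and> h \<le> g \<bullet> x" for x
    by (auto simp: G_def r_def less_eq_vec_def matrix_vector_mul_component inner_axis'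
        split: sum.splits)
  obtain \<mu> where \<mu>: "\<forall>k\<in>UNIV. 0 \<le> \<mu> k" "e = (\<Sum>k\<in>UNIV. \<mu> k *\<^sub>R G k)"
    "f \<le> (\<Sum>k\<in>UNIV. \<mu> k * r k)"
    proof (rule affine_farkas)
    show "finite (UNIV :: ('m + 'l + 'l + unit) set)" by simp
    show "\<forall>k\<in>UNIV. r k \<le> G k \<bullet> x0" using iff x0 by blast
    show "f \<le> e \<bullet> x" if "\<forall>k\<in>UNIV. r k \<le> G k \<bullet> x" for x using that iff implied by blast
  qed
  show ?thesis
  proof (rule that)
    show "0 \<le> (\<chi> i. \<mu> (Inl i))" "0 \<le> (\<chi> j. \<mu> (Inr (Inl j)))"
      "0 \<le> (\<chi> j. \<mu> (Inr (Inr (Inl j))))" "0 \<le> \<mu> (Inr (Inr (Inr ())))"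
      using \<mu>(1) by (simp_all add: less_eq_vec_def)
    show "e \<bullet> x = (\<chi> i. \<mu> (Inl i)) \<bullet> (W *v x) + (\<chi> j. \<mu> (Inr (Inl j))) \<bullet> x
        - (\<chi> j. \<mu> (Inr (Inr (Inl j)))) \<bullet> x + \<mu> (Inr (Inr (Inr ()))) * (g \<bullet> x)" for x
      unfolding \<mu>(2) sum_UNIV_sum_type
      by (simp add: G_def inner_add_left inner_diff_left inner_sum_left inner_vec_def [of "vec_lambda _"] matrix_vector_mul_component
          inner_axis' sum_negf UNIV_unit)
    show "f \<le> (\<chi> i. \<mu> (Inl i)) \<bullet> b + (\<chi> j. \<mu> (Inr (Inl j))) \<bullet> l
        - (\<chi> j. \<mu> (Inr (Inr (Inl j)))) \<bullet> u + \<mu> (Inr (Inr (Inr ()))) * h"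
      using \<mu>(3) unfolding sum_UNIV_sum_type
      by (simp add: r_def inner_vec_def [of "vec_lambda _"] sum_negf UNIV_unit)
  qed
qed

lemma inner_nonneg: "0 \<le> x \<Longrightarrow> 0 \<le> y \<Longrightarrow> 0 \<le> x \<bullet> y" for x y :: "real ^ 'n"
  by (simp add: inner_vec_def less_eq_vec_def sum_nonneg)

lemma inner_mono: "0 \<le> x \<Longrightarrow> y \<le> z \<Longrightarrow> x \<bullet> y \<le> x \<bullet> z" for x y z :: "real ^ 'n"
  by (simp add: inner_vec_def less_eq_vec_def sum_mono mult_left_mono)

section \<open>Separation and conic strong duality\<close>

text \<open>A small step from \<open>x\<close> against \<open>a\<close> stays in \<open>K\<close>
  and lowers the functional by a positive amount, yet the result is still nonnegative.\<close>

lemma dual_cone_interior_pos: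
  assumes a: "a \<in> dual_cone K" "a \<noteq> 0" and x: "x \<in> interior K"
  shows "0 < a \<bullet> x"
proof -
  obtain \<delta> where \<delta>: "0 < \<delta>" "cball x \<delta> \<subseteq> K"
    using x by (auto simp: mem_interior_cball)
  have "x - (\<delta> / norm a) *\<^sub>R a \<in> K"
    using \<delta> a(2) by (intro subsetD [OF \<delta>(2)]) (auto simp: dist_norm)
  then have "0 \<le> a \<bullet> (x - (\<delta> / norm a) *\<^sub>R a)"
    using a(1) by (auto simp: dual_cone_def)
  moreover have "0 < (\<delta> / norm a) * (a \<bullet> a)"
    using \<delta>(1) a(2) by simp
  ultimately show ?thesis by (simp add: inner_diff_right)
qed

text \<open>A hyperplane separating a set from a cone can be moved to the origin: 0 in
  \<open>K\<close> gives \<beta> \<le> 0, and scaling excludes negative values on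
  \<open>K\<close>.\<close>

lemma separate_from_cone:
  fixes K B :: "'a::euclidean_space set"
  assumes K: "convex_cone K" "interior K \<noteq> {}"
    and B: "convex B" "B \<noteq> {}" "B \<inter> K = {}"
  obtains a where "a \<noteq> 0" "a \<in> dual_cone K" "\<And>x. x \<in> B \<Longrightarrow> a \<bullet> x \<le> 0"
proof -
  have "convex K" using K by (simp add: convex_cone_def)
  moreover have "K \<noteq> {}" using K by (simp add: convex_cone_def)
  ultimately obtain a \<beta> where a: "a \<noteq> 0" "\<forall>x\<in>B. a \<bullet> x \<le> \<beta>" "\<forall>x\<in>K. \<beta> \<le> a \<bullet> x"
    using separating_hyperplane_sets [OF B(1) _ B(2)] B(3) by metis
  have "\<beta> \<le> 0" using a(3) convex_cone_contains_0 [OF K(1)] by force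
  have "0 \<le> a \<bullet> z" if "z \<in> K" for z
  proof (rule ccontr)
    assume neg: "\<not> 0 \<le> a \<bullet> z"
    define t where "t = (\<beta> - 1) / (a \<bullet> z)"
    have "t *\<^sub>R z \<in> K"
      using neg \<open>\<beta> \<le> 0\<close> that K(1)
      by (intro convex_cone_scaleR) (auto simp: t_def divide_nonpos_nonpos)
    with a(3) have "\<beta> \<le> a \<bullet> (t *\<^sub>R z)" by blast
    then show False using neg by (simp add: t_def)
  qed
  with a \<open>\<beta> \<le> 0\<close> show ?thesis by (intro that [of a]) (force simp: dual_cone_def)+
qed

lemma convex_atLeast_vec: "convex {b..}" for b :: "real ^ 'n"
proof (rule convexI)
  fix x y :: "real ^ 'n" and s t :: real
  assume "x \<in> {b..}" "y \<in> {b..}" and st: "0 \<le> s" "0 \<le> t" "s + t = 1"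
  then have "b $ i \<le> x $ i" "b $ i \<le> y $ i" for i by (auto simp: less_eq_vec_def)
  then have "s * b $ i + t * b $ i \<le> s * x $ i + t * y $ i" for i
    using st by (intro add_mono mult_left_mono) auto
  then show "s *\<^sub>R x + t *\<^sub>R y \<in> {b..}"
    using st(3) by (simp add: less_eq_vec_def flip: distrib_right)
qed

text \<open>Only the conic constraint needs a Slater point. Separating \<open>K\<close> from the points of the polyhedron
  with \<open>q \<bullet> x < c\<close> gives a functional \<open>a\<close> whose sign on the polyhedron is a linear implication, to
  which Farkas' lemma applies; the Slater point forces the multiplier \<open>\<theta>\<close> of \<open>q \<bullet> x \<le> c\<close> to be
  positive.\<close>

lemma conic_strong_duality:
  fixes W :: "real ^ 'l ^ 'm" and K :: "(real ^ 'l) set"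
  assumes K: "convex_cone K"
    and x0: "b \<le> W *v x0" "l \<le> x0" "x0 \<le> u" "x0 \<in> interior K"
    and bound: "\<And>x. b \<le> W *v x \<Longrightarrow> l \<le> x \<Longrightarrow> x \<le> u \<Longrightarrow> x \<in> K \<Longrightarrow> c \<le> q \<bullet> x"
  obtains \<gamma> \<tau>L \<tau>U where "0 \<le> \<gamma>" "0 \<le> \<tau>L" "0 \<le> \<tau>U"
    and "q - transpose W *v \<gamma> + \<tau>U - \<tau>L \<in> dual_cone K"
    and "c \<le> \<gamma> \<bullet> b + \<tau>L \<bullet> l - \<tau>U \<bullet> u"
proof -
  define P where "P = {x. b \<le> W *v x \<and> l \<le> x \<and> x \<le> u}"
  have "convex P"
  proof -
    have "convex ((*v) W -` {b..} \<inter> {l..} \<inter> uminus -` {- u..})"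
      by (intro convex_Int convex_linear_vimage matrix_vector_mul_linear linear_uminus
          convex_atLeast_vec)
    also have "(*v) W -` {b..} \<inter> {l..} \<inter> uminus -` {- u..} = P"
      by (auto simp: P_def less_eq_vec_def)
    finally show ?thesis .
  qed
  define B where "B = P \<inter> {x. q \<bullet> x < c}"
  show ?thesis
  proof (cases "B = {}")
    \<comment> \<open>The polyhedron alone implies the bound, so the extra inequality is filled with
      the vacuous \<open>0 \<le> 0 \<bullet> x\<close>.\<close>
    case True
    obtain \<gamma> \<tau>L \<tau>U :: "real ^ _" and \<theta> :: real
      where d: "0 \<le> \<gamma>" "0 \<le> \<tau>L" "0 \<le> \<tau>U" "0 \<le> \<theta>"
      "\<And>x. q \<bullet> x = \<gamma> \<bullet> (W *v x) + \<tau>L \<bullet> x - \<tau>U \<bullet> x + \<theta> * (0 \<bullet> x)"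
      "c \<le> \<gamma> \<bullet> b + \<tau>L \<bullet> l - \<tau>U \<bullet> u + \<theta> * 0"
    proof (rule box_farkas [of b W x0 l u 0 0 c q])
      show "c \<le> q \<bullet> x" if "b \<le> W *v x" "l \<le> x" "x \<le> u" for x
        using that True by (auto simp: B_def P_def not_less)
    qed (use x0 in auto)
    then show ?thesis
      by (intro that [of \<gamma> \<tau>L \<tau>U])
        (auto simp: dual_cone_def inner_diff_left inner_add_left dot_lmul_matrix)
  next
    case False
    then obtain x1 where x1: "x1 \<in> P" "q \<bullet> x1 < c" by (auto simp: B_def)
    have "convex B"
      unfolding B_def by (intro convex_Int \<open>convex P\<close> convex_halfspace_lt)
    moreover have "B \<inter> K = {}"
      using bound by (force simp: B_def P_def)
    ultimately obtain a where a: "a \<noteq> 0" "a \<in> dual_cone K" "\<And>x. x \<in> B \<Longrightarrow> a \<bullet> x \<le> 0"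
      using separate_from_cone [OF K _ _ False] x0(4) by blast
    \<comment> \<open>Separation covers only \<open>q \<bullet> x < c\<close>. To reach equality,
      \<open>x\<close> is moved slightly towards \<open>x1\<close>, where the inequality is strict;
      \<open>t\<close> is so small that \<open>a\<close> keeps at least half its value.\<close>
    have le: "a \<bullet> x \<le> 0" if x: "x \<in> P" "q \<bullet> x \<le> c" for x
    proof (rule ccontr)
      assume pos: "\<not> a \<bullet> x \<le> 0"
      define t where "t = (a \<bullet> x) / (2 * (a \<bullet> x + \<bar>a \<bullet> x1\<bar>))"
      have t: "0 < t" "t < 1" using pos by (auto simp: t_def field_simps)
      define z where "z = (1 - t) *\<^sub>R x + t *\<^sub>R x1"
      have "z \<in> P"
        unfolding z_def using convexD [OF \<open>convex P\<close> x(1) x1(1)] t by auto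
      moreover have "q \<bullet> z < c"
      proof -
        have "q \<bullet> z = (1 - t) * (q \<bullet> x) + t * (q \<bullet> x1)" by (simp add: z_def inner_add_right)
        also have "\<dots> < (1 - t) * c + t * c"
          using t x(2) x1(2) by (intro add_le_less_mono mult_left_mono mult_strict_left_mono) auto
        finally show ?thesis by (simp add: algebra_simps)
      qed
      ultimately have "a \<bullet> z \<le> 0" using a(3) by (simp add: B_def)
      moreover have "a \<bullet> z = a \<bullet> x - t * (a \<bullet> x - a \<bullet> x1)"
        by (simp add: z_def inner_add_right algebra_simps)
      moreover have "t * (a \<bullet> x - a \<bullet> x1) \<le> t * (a \<bullet> x + \<bar>a \<bullet> x1\<bar>)"
        using t by (intro mult_left_mono) auto
      moreover have "t * (a \<bullet> x + \<bar>a \<bullet> x1\<bar>) = (a \<bullet> x) / 2"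
        using pos by (simp add: t_def field_simps)
      ultimately show False using pos by linarith
    qed
    obtain \<gamma> \<tau>L \<tau>U :: "real ^ _" and \<theta> :: real
      where d: "0 \<le> \<gamma>" "0 \<le> \<tau>L" "0 \<le> \<tau>U" "0 \<le> \<theta>"
      "\<And>x. - a \<bullet> x = \<gamma> \<bullet> (W *v x) + \<tau>L \<bullet> x - \<tau>U \<bullet> x + \<theta> * (- q \<bullet> x)"
      "0 \<le> \<gamma> \<bullet> b + \<tau>L \<bullet> l - \<tau>U \<bullet> u + \<theta> * - c"
    proof (rule box_farkas [of b W x1 l u "- c" "- q" 0 "- a"])
      show "0 \<le> - a \<bullet> x" if "b \<le> W *v x" "l \<le> x" "x \<le> u" "- c \<le> - q \<bullet> x" for x
        using that le [of x] by (auto simp: P_def)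
    qed (use x1 in \<open>auto simp: P_def\<close>)
    have "0 < a \<bullet> x0" using dual_cone_interior_pos [OF a(2,1) x0(4)] .
    \<comment> \<open>Without \<theta> the identity at the Slater point makes
      \<open>- a \<bullet> x0\<close> nonnegative, whereas \<open>a\<close> is positive on the
      interior of \<open>K\<close>.\<close>
    have "\<theta> \<noteq> 0"
    proof
      assume "\<theta> = 0"
      moreover have "\<gamma> \<bullet> b \<le> \<gamma> \<bullet> (W *v x0)" "\<tau>L \<bullet> l \<le> \<tau>L \<bullet> x0" "\<tau>U \<bullet> x0 \<le> \<tau>U \<bullet> u"
        using x0 d by (auto intro: inner_mono)
      ultimately show False using d(5) [of x0] d(6) \<open>0 < a \<bullet> x0\<close> by simp
    qed
    with d(4) have \<theta>: "0 < \<theta>" by simp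
    show ?thesis
    proof (rule that)
      show "0 \<le> (1 / \<theta>) *\<^sub>R \<gamma>" "0 \<le> (1 / \<theta>) *\<^sub>R \<tau>L" "0 \<le> (1 / \<theta>) *\<^sub>R \<tau>U"
        using d \<theta> by (simp_all add: less_eq_vec_def)
      \<comment> \<open>By the Farkas identity this vector is \<open>a\<close> divided by
        \<theta>.\<close>
      show "q - transpose W *v ((1 / \<theta>) *\<^sub>R \<gamma>) + (1 / \<theta>) *\<^sub>R \<tau>U - (1 / \<theta>) *\<^sub>R \<tau>L \<in> dual_cone K"
        unfolding dual_cone_def
      proof (intro CollectI ballI)
        fix x assume "x \<in> K"
        then have "0 \<le> (a \<bullet> x) / \<theta>" using a(2) \<theta> by (simp add: dual_cone_def)
        also have "(a \<bullet> x) / \<theta>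
            = q \<bullet> x - (\<gamma> \<bullet> (W *v x)) / \<theta> + (\<tau>U \<bullet> x) / \<theta> - (\<tau>L \<bullet> x) / \<theta>"
          using d(5) [of x] \<theta> by (simp add: field_simps)
        finally show "0 \<le> (q - transpose W *v ((1 / \<theta>) *\<^sub>R \<gamma>)
            + (1 / \<theta>) *\<^sub>R \<tau>U - (1 / \<theta>) *\<^sub>R \<tau>L) \<bullet> x"
          by (simp add: inner_diff_left inner_add_left dot_lmul_matrix)
      qed
      have "c \<le> (\<gamma> \<bullet> b + \<tau>L \<bullet> l - \<tau>U \<bullet> u) / \<theta>"
        using d(6) \<theta> by (simp add: pos_le_divide_eq mult.commute)
      then show "c \<le> (1 / \<theta>) *\<^sub>R \<gamma> \<bullet> b + (1 / \<theta>) *\<^sub>R \<tau>L \<bullet> l - (1 / \<theta>) *\<^sub>R \<tau>U \<bullet> u"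
        by (simp add: add_divide_distrib diff_divide_distrib)
    qed
  qed
qed


section \<open>Leaves of the branch-and-cut tree and their cuts\<close>

lemma bc_leaves_finite: "bc_leaves D y \<omega> V \<Longrightarrow> finite V"
  by (induction rule: bc_leaves.induct) auto

text \<open>The guards of \<open>branch\<close> make each new bound tighter than the one it
  replaces, and only integer coordinates are branched on.\<close>

lemma bc_leaves_bounds:
  assumes "bc_leaves D y \<omega> V" and "(l, u) \<in> V"
  shows "zL D \<omega> $ j \<le> l $ j \<and> u $ j \<le> zU D \<omega> $ j \<and>
         (j \<notin> int_vars D \<longrightarrow> l $ j = zL D \<omega> $ j \<and> u $ j = zU D \<omega> $ j)"
  using assms
proof (induction arbitrary: l u rule: bc_leaves.induct)
  case (branch V l' u' i t)
  show ?case
    using branch.IH [OF branch.hyps(2)] branch.IH [of l u] branch.hyps branch.prems by auto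
qed auto

text \<open>The root bounds may be fractional, but they enclose the integer \<open>x $ i\<close>;
  every later bound is itself an integer. This supplies the integer prescription that strict
  recourse asks for.\<close>

lemma bc_leaves_integer:
  assumes "bc_leaves D y \<omega> V" and "csub_feasible D y \<omega> x"
    and "(l, u) \<in> V" and "i \<in> int_vars D" and "l $ i \<le> u $ i"
  shows "\<exists>t\<in>\<int>. l $ i \<le> t \<and> t \<le> u $ i"
  using assms(1,3,5)
proof (induction arbitrary: l u rule: bc_leaves.induct)
  case root
  then show ?case
    using assms(2,4) by (intro bexI [of _ "x $ i"]) (auto simp: csub_feasible_def less_eq_vec_def)
next
  case (branch V l' u' j t)
  consider "(l, u) \<in> V" | "l = l'" "u = (\<chi> k. if k = j then of_int t else u' $ k)"
    | "u = u'" "l = (\<chi> k. if k = j then of_int t + 1 else l' $ k)"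
    using branch.prems(1) by auto
  then show ?case
  proof cases
    case 1
    then show ?thesis using branch.IH branch.prems(2) by blast
  next
    case 2
    show ?thesis
    proof (cases "i = j")
      case True
      then show ?thesis using 2 branch.prems(2) by (intro bexI [of _ "of_int t"]) auto
    next
      case False
      then show ?thesis using 2 branch.prems(2) branch.IH [OF branch.hyps(2)] by simp
    qed
  next
    case 3
    show ?thesis
    proof (cases "i = j")
      case True
      then show ?thesis using 3 branch.prems(2) by (intro bexI [of _ "of_int t + 1"]) auto
    next
      case False
      then show ?thesis using 3 branch.prems(2) branch.IH [OF branch.hyps(2)] by simp
    qed
  qed
next
  case (discard V v)
  then show ?case by blast
qed

text \<open>Strict recourse fixes the integer coordinates inside the leaf; on the others the leaf
  still has the root bounds, which every point of \<open>CSub\<close> obeys.\<close>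

lemma leaf_slater_point:
  assumes "strict_recourse D" and "first_stage_feasible D y"
    and leaf: "bc_leaves D y \<omega> V" "(l, u) \<in> V"
    and x1: "\<And>i. i \<in> int_vars D \<Longrightarrow> x1 $ i \<in> \<int> \<and> l $ i \<le> x1 $ i \<and> x1 $ i \<le> u $ i"
  obtains x where "node_feasible D y \<omega> (l, u) x" and "x \<in> interior (cone2 D)"
proof -
  have "x1 $ i \<in> \<int> \<and> zL D \<omega> $ i \<le> x1 $ i \<and> x1 $ i \<le> zU D \<omega> $ i" if "i \<in> int_vars D" for i
    using x1 [OF that] bc_leaves_bounds [OF leaf, of i] by auto
  then obtain x where x: "\<forall>i\<in>int_vars D. x $ i = x1 $ i" "csub_strictly_feasible D y \<omega> x"
    using assms(1,2) unfolding strict_recourse_def by blast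
  have "l $ j \<le> x $ j \<and> x $ j \<le> u $ j" for j
    using x x1 [of j] bc_leaves_bounds [OF leaf, of j]
    by (cases "j \<in> int_vars D")
      (auto simp: csub_strictly_feasible_def csub_feasible_def less_eq_vec_def)
  with x(2) show ?thesis
    by (intro that [of x])
      (auto simp: csub_strictly_feasible_def csub_feasible_def node_feasible_def less_eq_vec_def)
qed

text \<open>The leaves are computed at \<open>y\<close>, but they cover the integral points of every other
  subproblem as well: by strict recourse, a node that is infeasible at \<open>y\<close> contains no point
  with integral \<open>int_vars\<close>-coordinates.\<close>

lemma bc_leaves_cover:
  assumes "strict_recourse D" and "first_stage_feasible D y" and "bc_leaves D y \<omega> V"
    and "zL D \<omega> \<le> x" "x \<le> zU D \<omega>" and int: "\<forall>i\<in>int_vars D. x $ i \<in> \<int>"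
  shows "\<exists>v\<in>V. fst v \<le> x \<and> x \<le> snd v"
  using assms(3)
proof (induction rule: bc_leaves.induct)
  case root
  then show ?case using assms by simp
next
  case (branch V l u i t)
  then obtain v where v: "v \<in> V" "fst v \<le> x" "x \<le> snd v" by blast
  show ?case
  proof (cases "v = (l, u)")
    case False
    with v show ?thesis by blast
  next
    case True
    obtain s where s: "x $ i = of_int s"
      using int branch.hyps(3) by (auto elim: Ints_cases)
    show ?thesis
    proof (cases "s \<le> t")
      case True
      then have "x \<le> (\<chi> j. if j = i then of_int t else u $ j)"
        using v s \<open>v = (l, u)\<close> by (auto simp: less_eq_vec_def)
      then show ?thesis using v \<open>v = (l, u)\<close> by auto
    next
      case False
      then have "of_int (t + 1) \<le> (of_int s :: real)" by (simp only: of_int_le_iff)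
      then have "(\<chi> j. if j = i then of_int t + 1 else l $ j) \<le> x"
        using v s \<open>v = (l, u)\<close> by (auto simp: less_eq_vec_def)
      then show ?thesis using v \<open>v = (l, u)\<close> by auto
    qed
  qed
next
  case (discard V v)
  then obtain v' where v': "v' \<in> V" "fst v' \<le> x" "x \<le> snd v'" by blast
  have "v' \<noteq> v"
  proof
    assume "v' = v"
    obtain l u where lu: "v' = (l, u)" by (cases v')
    then have "(l, u) \<in> V" using v' by simp
    have "x $ i \<in> \<int> \<and> l $ i \<le> x $ i \<and> x $ i \<le> u $ i" if "i \<in> int_vars D" for i
      using int v' lu that by (simp add: less_eq_vec_def)
    then obtain z where "node_feasible D y \<omega> (l, u) z"
      using leaf_slater_point [OF assms(1,2) discard.hyps(1) \<open>(l, u) \<in> V\<close>] by metis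
    with discard.hyps(3) \<open>v' = v\<close> lu show False by blast
  qed
  with v' show ?case by blast
qed

section \<open>Dual bounds at the leaves\<close>

text \<open>Dual feasibility does not involve \<open>y\<close>, so a dual solution computed at one
  iterate gives a bound at every first-stage point.\<close>

lemma weak_duality:
  assumes "dual_feasible D \<omega> d" and "node_feasible D y \<omega> v x"
  shows "dual_value D y \<omega> v d \<le> qvec D \<omega> \<bullet> x"
proof -
  have x: "x \<in> cone2 D" "fst v \<le> x" "x \<le> snd v" "rvec D \<omega> - Tmat D \<omega> *v y \<le> Wmat D \<omega> *v x"
    using assms(2) by (auto simp: node_feasible_def)
  have "0 \<le> (qvec D \<omega> - slk d - transpose (Wmat D \<omega>) *v gam d + tauU d - tauL d) \<bullet> x"
    and "0 \<le> slk d \<bullet> x"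
    using assms(1) x(1) by (auto simp: dual_feasible_def dual_cone_def)
  then have "gam d \<bullet> (Wmat D \<omega> *v x) + tauL d \<bullet> x - tauU d \<bullet> x \<le> qvec D \<omega> \<bullet> x"
    by (simp add: inner_diff_left inner_add_left dot_lmul_matrix)
  moreover have "gam d \<bullet> (rvec D \<omega> - Tmat D \<omega> *v y) \<le> gam d \<bullet> (Wmat D \<omega> *v x)"
    "tauL d \<bullet> fst v \<le> tauL d \<bullet> x" "tauU d \<bullet> x \<le> tauU d \<bullet> snd v"
    using assms(1) x by (auto simp: dual_feasible_def intro: inner_mono)
  ultimately show ?thesis by (simp add: dual_value_def)
qed

lemma dual_value_eq: "dual_value D y \<omega> v d = Rcoef D \<omega> d \<bullet> y + Scoef D \<omega> v d"
  by (simp add: dual_value_def Rcoef_def Scoef_def dot_lmul_matrix inner_diff_right)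

text \<open>Over an empty box the dual is unbounded: raising \<open>tauL\<close> and
  \<open>tauU\<close> together in coordinate \<open>i\<close> keeps feasibility and gains
  \<open>l $ i - u $ i\<close>. Hence a leaf with an optimal dual solution has a nonempty
  box.\<close>

lemma dual_optimal_box_nonempty:
  assumes "dual_optimal D y \<omega> (l, u) d"
  shows "l $ i \<le> u $ i"
proof (rule ccontr)
  assume "\<not> l $ i \<le> u $ i"
  define d' where "d' = d\<lparr>tauL := tauL d + axis i 1, tauU := tauU d + axis i 1\<rparr>"
  have "0 \<le> (axis i 1 :: real ^ _)" by (auto simp: less_eq_vec_def axis_def)
  then have "dual_feasible D \<omega> d'"
    using assms by (auto simp: d'_def dual_optimal_def dual_feasible_def algebra_simps)
  then have "dual_value D y \<omega> (l, u) d' \<le> dual_value D y \<omega> (l, u) d"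
    using assms by (auto simp: dual_optimal_def)
  with \<open>\<not> l $ i \<le> u $ i\<close> show False
    by (simp add: dual_value_def d'_def inner_add_left inner_axis')
qed

text \<open>The box is nonempty and contains an integer in each integer coordinate, so the leaf has
  a Slater point and conic duality applies. Using a lower bound \<open>c\<close> avoids any appeal
  to a primal minimizer.\<close>

lemma leaf_strong_duality:
  assumes "convex_cone (cone2 D)" and "strict_recourse D" and "first_stage_feasible D y"
    and "csub_feasible D y \<omega> x0"
    and leaf: "bc_leaves D y \<omega> V" "v \<in> V" and opt: "dual_optimal D y \<omega> v d"
    and bound: "\<And>x. node_feasible D y \<omega> v x \<Longrightarrow> c \<le> qvec D \<omega> \<bullet> x"
  shows "c \<le> dual_value D y \<omega> v d"
proof -
  obtain l u where v: "v = (l, u)" by (cases v)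
  note leaf' = leaf [unfolded v] and opt' = opt [unfolded v]
  have "\<exists>t\<in>\<int>. l $ i \<le> t \<and> t \<le> u $ i" if "i \<in> int_vars D" for i
    using bc_leaves_integer [OF leaf'(1) assms(4) leaf'(2) that]
      dual_optimal_box_nonempty [OF opt'] by blast
  then obtain t where t: "\<And>i. i \<in> int_vars D \<Longrightarrow> t i \<in> \<int> \<and> l $ i \<le> t i \<and> t i \<le> u $ i"
    by metis
  obtain x where x: "node_feasible D y \<omega> (l, u) x" "x \<in> interior (cone2 D)"
    using leaf_slater_point [OF assms(2,3) leaf', of "\<chi> i. t i"] t by auto
  obtain \<gamma> \<tau>L \<tau>U where dual: "0 \<le> \<gamma>" "0 \<le> \<tau>L" "0 \<le> \<tau>U"
    "qvec D \<omega> - transpose (Wmat D \<omega>) *v \<gamma> + \<tau>U - \<tau>L \<in> dual_cone (cone2 D)"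
    "c \<le> \<gamma> \<bullet> (rvec D \<omega> - Tmat D \<omega> *v y) + \<tau>L \<bullet> l - \<tau>U \<bullet> u"
    using conic_strong_duality [OF assms(1), of "rvec D \<omega> - Tmat D \<omega> *v y" "Wmat D \<omega>" x l u c "qvec D \<omega>"]
      x bound v by (auto simp: node_feasible_def)
  \<comment> \<open>The whole conic multiplier is left in the first membership of
    \<open>dual_feasible\<close>, so the slack can be zero.\<close>
  define d' where "d' = \<lparr>gam = \<gamma>, tauL = \<tau>L, tauU = \<tau>U, slk = 0\<rparr>"
  have "dual_feasible D \<omega> d'"
    using dual by (auto simp: d'_def dual_feasible_def dual_cone_def)
  then have "dual_value D y \<omega> v d' \<le> dual_value D y \<omega> v d"
    using opt by (auto simp: dual_optimal_def)
  moreover have "c \<le> dual_value D y \<omega> v d'"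
    using dual(5) by (simp add: d'_def dual_value_def v)
  ultimately show ?thesis by simp
qed

section \<open>Scenario cuts\<close>

text \<open>The LP variables are Farkas multipliers: \<sigma> for \<open>F y \<ge> a\<close>,
  \<gamma> for \<open>y \<le> 1\<close>, while the inequality sign in the slope constraint accounts
  for \<open>y \<ge> 0\<close>.\<close>

lemma cut_below_dual_value:
  assumes "cut_lp_feasible D \<omega> V d lam zet \<sigma> \<gamma>" and "v \<in> V" and y: "first_stage_feasible D y"
  shows "lam \<bullet> y + zet \<le> dual_value D y \<omega> v (d v)"
proof -
  have lp: "0 \<le> \<sigma> v" "0 \<le> \<gamma> v"
    "lam - Rcoef D \<omega> (d v) + transpose (Fmat D) *v \<sigma> v - \<gamma> v \<le> 0"
    "zet - \<sigma> v \<bullet> avec D - Scoef D \<omega> v (d v) + \<gamma> v \<bullet> 1 \<le> 0"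
    using assms(1,2) by (auto simp: cut_lp_feasible_def)
  have y01: "y $ i = 0 \<or> y $ i = 1" for i
    using y by (auto simp: first_stage_feasible_def)
  have "0 \<le> y $ i" "y $ i \<le> 1" for i using y01 [of i] by auto
  then have ge: "0 \<le> y" and le: "y \<le> 1"
    by (auto simp: less_eq_vec_def)
  have "0 \<le> y \<bullet> - (lam - Rcoef D \<omega> (d v) + transpose (Fmat D) *v \<sigma> v - \<gamma> v)"
    using ge lp(3) by (intro inner_nonneg) auto
  then have "lam \<bullet> y \<le> Rcoef D \<omega> (d v) \<bullet> y - \<sigma> v \<bullet> (Fmat D *v y) + \<gamma> v \<bullet> y"
    by (simp add: inner_diff_right inner_add_right inner_commute [of y] dot_lmul_matrix)
  moreover have "\<sigma> v \<bullet> avec D \<le> \<sigma> v \<bullet> (Fmat D *v y)"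
    using lp(1) y by (intro inner_mono) (auto simp: first_stage_feasible_def)
  moreover have "\<gamma> v \<bullet> y \<le> \<gamma> v \<bullet> 1" using lp(2) le by (rule inner_mono)
  ultimately show ?thesis using lp(4) by (simp add: dual_value_eq)
qed

text \<open>Since \<open>y\<close> is binary, the minimum of the affine leaf functions at \<open>y\<close> is reached by one affine
  function with slope \<open>M\<close> on the support of \<open>y\<close> and \<open>- M\<close> off it, \<open>M\<close> bounding all leaf slopes.\<close>

lemma cut_lp_tight:
  assumes opt: "cut_lp_optimal D y \<omega> V d lam zet" and "finite V"
    and y: "first_stage_feasible D y"
    and m: "\<And>v. v \<in> V \<Longrightarrow> m \<le> dual_value D y \<omega> v (d v)"
  shows "m \<le> lam \<bullet> y + zet"
proof -
  \<comment> \<open>A sum, not a maximum, so that it bounds every slope and needs no nonempty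
    \<open>V\<close>.\<close>
  define M where "M = (\<Sum>v\<in>V. \<Sum>i\<in>UNIV. \<bar>Rcoef D \<omega> (d v) $ i\<bar>)"
  have M: "\<bar>Rcoef D \<omega> (d v) $ i\<bar> \<le> M" if "v \<in> V" for v i
  proof -
    have "\<bar>Rcoef D \<omega> (d v) $ i\<bar> \<le> (\<Sum>i\<in>UNIV. \<bar>Rcoef D \<omega> (d v) $ i\<bar>)"
      by (intro member_le_sum) auto
    also have "\<dots> \<le> M"
      unfolding M_def using that \<open>finite V\<close>
      by (intro member_le_sum [of v V "\<lambda>v. \<Sum>i\<in>UNIV. \<bar>Rcoef D \<omega> (d v) $ i\<bar>"])
         (auto intro: sum_nonneg)
    finally show ?thesis .
  qed
  have y01: "y $ i = 0 \<or> y $ i = 1" for i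
    using y by (auto simp: first_stage_feasible_def)
  \<comment> \<open>On the support of \<open>y\<close> this equals the excess of the slope over the
    leaf slope; off it \<gamma> vanishes and the slope \<open>- M\<close> is small enough.\<close>
  define \<gamma> where "\<gamma> = (\<lambda>v. \<chi> i. (M - Rcoef D \<omega> (d v) $ i) * y $ i)"
  define lam' :: "real ^ 'a" where "lam' = (\<chi> i. M * (2 * y $ i - 1))"
  have lam': "lam' \<bullet> y = (\<Sum>i\<in>UNIV. M * y $ i)"
    unfolding inner_vec_def lam'_def using y01 by (intro sum.cong refl) force
  \<comment> \<open>The intercept is chosen so that the cut takes exactly the value \<open>m\<close>
    at \<open>y\<close>.\<close>
  have "cut_lp_feasible D \<omega> V d lam' (m - lam' \<bullet> y) (\<lambda>_. 0) \<gamma>"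
    unfolding cut_lp_feasible_def
  proof (intro ballI conjI)
    fix v assume v: "v \<in> V"
    show "0 \<le> \<gamma> v"
      unfolding \<gamma>_def less_eq_vec_def
    proof
      fix i
      show "0 $ i \<le> (\<chi> i. (M - Rcoef D \<omega> (d v) $ i) * y $ i) $ i"
        using M [OF v, of i] y01 [of i] by auto
    qed
    show "lam' - Rcoef D \<omega> (d v) + transpose (Fmat D) *v 0 - \<gamma> v \<le> 0"
      unfolding \<gamma>_def less_eq_vec_def
    proof
      fix i
      show "(lam' - Rcoef D \<omega> (d v) + transpose (Fmat D) *v 0
          - (\<chi> i. (M - Rcoef D \<omega> (d v) $ i) * y $ i)) $ i \<le> 0 $ i"
        using M [OF v, of i] y01 [of i] by (auto simp: lam'_def)
    qed
    have "\<gamma> v \<bullet> 1 = lam' \<bullet> y - Rcoef D \<omega> (d v) \<bullet> y"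
      unfolding lam' by (simp add: \<gamma>_def inner_vec_def left_diff_distrib sum_subtractf)
    then show "m - lam' \<bullet> y - 0 \<bullet> avec D - Scoef D \<omega> v (d v) + \<gamma> v \<bullet> 1 \<le> 0"
      using m [OF v] by (simp add: dual_value_eq)
  qed simp
  then have "lam' \<bullet> y + (m - lam' \<bullet> y) \<le> lam \<bullet> y + zet"
    using opt unfolding cut_lp_optimal_def by blast
  then show ?thesis by simp
qed

section \<open>Second-stage values and worst-case expectations\<close>

text \<open>A real \<open>Inf\<close> needs a lower bound; the cost is bounded on the compact box of
  variable bounds.\<close>

lemma Qval_le:
  assumes "csub_feasible D y \<omega> x"
  shows "Qval D y \<omega> \<le> qvec D \<omega> \<bullet> x"
  unfolding Qval_def
proof (rule cInf_lower)
  show "bdd_below {qvec D \<omega> \<bullet> x |x. csub_feasible D y \<omega> x}"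
  proof (rule bdd_below_mono)
    have "compact ((\<lambda>x. qvec D \<omega> \<bullet> x) ` cbox (zL D \<omega>) (zU D \<omega>))"
      by (intro compact_continuous_image continuous_intros compact_cbox)
    then show "bdd_below ((\<lambda>x. qvec D \<omega> \<bullet> x) ` cbox (zL D \<omega>) (zU D \<omega>))"
      by (intro bounded_imp_bdd_below compact_imp_bounded)
    show "{qvec D \<omega> \<bullet> x |x. csub_feasible D y \<omega> x} \<subseteq> (\<lambda>x. qvec D \<omega> \<bullet> x) ` cbox (zL D \<omega>) (zU D \<omega>)"
      by (auto simp: csub_feasible_def simp flip: interval_cbox_cart)
  qed
qed (use assms in blast)

lemma le_Qval:
  assumes "complete_recourse D" and "first_stage_feasible D y"
    and "\<And>x. csub_feasible D y \<omega> x \<Longrightarrow> c \<le> qvec D \<omega> \<bullet> x"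
  shows "c \<le> Qval D y \<omega>"
  unfolding Qval_def
  using assms by (intro cInf_greatest) (auto simp: complete_recourse_def)

lemma worst_case_bdd:
  assumes "drp_data D"
  shows "bdd_above ((\<lambda>p. \<Sum>\<omega>\<in>UNIV. p $ \<omega> * v \<omega>) ` ambiguity D)"
proof (rule bdd_aboveI2)
  fix p assume "p \<in> ambiguity D"
  then have p: "0 \<le> p $ \<omega>" "(\<Sum>\<omega>\<in>UNIV. p $ \<omega>) = 1" for \<omega>
    using assms by (auto simp: drp_data_def)
  have "(\<Sum>\<omega>\<in>UNIV. p $ \<omega> * v \<omega>) \<le> (\<Sum>\<omega>\<in>UNIV. p $ \<omega> * (\<Sum>\<omega>\<in>UNIV. \<bar>v \<omega>\<bar>))"
  proof (intro sum_mono mult_left_mono p)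
    fix \<omega>
    have "\<bar>v \<omega>\<bar> \<le> (\<Sum>\<omega>\<in>UNIV. \<bar>v \<omega>\<bar>)" by (intro member_le_sum) auto
    then show "v \<omega> \<le> (\<Sum>\<omega>\<in>UNIV. \<bar>v \<omega>\<bar>)" by linarith
  qed
  also have "\<dots> = (\<Sum>\<omega>\<in>UNIV. \<bar>v \<omega>\<bar>)" using p(2) by (simp flip: sum_distrib_right)
  finally show "(\<Sum>\<omega>\<in>UNIV. p $ \<omega> * v \<omega>) \<le> (\<Sum>\<omega>\<in>UNIV. \<bar>v \<omega>\<bar>)" .
qed

lemma le_worst_case:
  assumes "drp_data D" and "p \<in> ambiguity D"
  shows "(\<Sum>\<omega>\<in>UNIV. p $ \<omega> * v \<omega>) \<le> worst_case D v"
  unfolding worst_case_def using worst_case_bdd [OF assms(1)] assms(2) by (rule cSUP_upper2) simp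

lemma worst_case_mono:
  assumes "drp_data D" and "ambiguity D \<noteq> {}" and "\<And>\<omega>. v \<omega> \<le> w \<omega>"
  shows "worst_case D v \<le> worst_case D w"
  unfolding worst_case_def
proof (intro cSUP_mono worst_case_bdd assms)
  fix p assume "p \<in> ambiguity D"
  then show "\<exists>p'\<in>ambiguity D. (\<Sum>\<omega>\<in>UNIV. p $ \<omega> * v \<omega>) \<le> (\<Sum>\<omega>\<in>UNIV. p' $ \<omega> * w \<omega>)"
    using assms(1,3) by (intro bexI [of _ p] sum_mono mult_left_mono) (auto simp: drp_data_def)
qed

text \<open>Binary vectors are indicator vectors of sets of coordinates.\<close>

lemma finite_first_stage: "finite {y. first_stage_feasible D y}"
proof (rule finite_subset)
  show "{y. first_stage_feasible D y} \<subseteq> range (\<lambda>S. \<chi> i. if i \<in> S then 1 else 0)"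
  proof
    fix y :: "real ^ 'a" assume "y \<in> {y. first_stage_feasible D y}"
    then have "y = (\<chi> i. if i \<in> {i. y $ i = 1} then 1 else 0)"
      by (auto simp: first_stage_feasible_def vec_eq_iff)
    then show "y \<in> range (\<lambda>S. \<chi> i. if i \<in> S then 1 else 0)" by (rule range_eqI)
  qed
qed simp


section \<open>Convergence\<close>

text \<open>Leaves computed at \<open>it_y A k\<close> also cover each second-stage point at
  \<open>y\<close>; in the covering leaf the cut lies below the dual value, and that below the cost.
  This includes iterations whose subproblems were solved inexactly.\<close>

lemma scenario_cut_valid:
  assumes "complete_recourse D" and "strict_recourse D" and it: "iteration D A k"
    and y: "first_stage_feasible D y"
  shows "it_lam A k \<omega> \<bullet> y + it_zeta A k \<omega> \<le> Qval D y \<omega>"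
proof (rule le_Qval [OF assms(1) y])
  fix x assume x: "csub_feasible D y \<omega> x"
  have yk: "first_stage_feasible D (it_y A k)" and tree: "bc_leaves D (it_y A k) \<omega> (it_leaves A k \<omega>)"
    using it by (auto simp: iteration_def master_solution_def master_feasible_def)
  obtain v where v: "v \<in> it_leaves A k \<omega>" "fst v \<le> x" "x \<le> snd v"
    using bc_leaves_cover [OF assms(2) yk tree, of x] x by (meson csub_feasible_def)
  obtain \<sigma> \<gamma> where "cut_lp_feasible D \<omega> (it_leaves A k \<omega>) (it_dual A k \<omega>)
      (it_lam A k \<omega>) (it_zeta A k \<omega>) \<sigma> \<gamma>"
    using it unfolding iteration_def cut_lp_optimal_def by blast
  then have "it_lam A k \<omega> \<bullet> y + it_zeta A k \<omega> \<le> dual_value D y \<omega> v (it_dual A k \<omega> v)"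
    using v(1) y by (rule cut_below_dual_value)
  also have "\<dots> \<le> qvec D \<omega> \<bullet> x"
  proof (rule weak_duality)
    show "dual_feasible D \<omega> (it_dual A k \<omega> v)"
      using it v(1) by (auto simp: iteration_def dual_optimal_def)
    show "node_feasible D y \<omega> v x"
      using x v by (simp add: csub_feasible_def node_feasible_def)
  qed
  finally show "it_lam A k \<omega> \<bullet> y + it_zeta A k \<omega> \<le> qvec D \<omega> \<bullet> x" .
qed

text \<open>Fathoming makes the incumbent cost a lower bound at all leaves; strong duality carries
  it to the dual values, and LP optimality to the cut.\<close>

lemma scenario_cut_tight:
  assumes "drp_data D" and "strict_recourse D" and it: "iteration D A k"
    and solved: "solved_to_optimality D (it_y A k) \<omega> (it_leaves A k \<omega>) (it_x A k \<omega>)"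
  shows "qvec D \<omega> \<bullet> it_x A k \<omega> \<le> it_lam A k \<omega> \<bullet> it_y A k + it_zeta A k \<omega>"
proof -
  have yk: "first_stage_feasible D (it_y A k)" and tree: "bc_leaves D (it_y A k) \<omega> (it_leaves A k \<omega>)"
    and x: "csub_feasible D (it_y A k) \<omega> (it_x A k \<omega>)"
    and lp: "cut_lp_optimal D (it_y A k) \<omega> (it_leaves A k \<omega>) (it_dual A k \<omega>)
      (it_lam A k \<omega>) (it_zeta A k \<omega>)"
    using it by (auto simp: iteration_def master_solution_def master_feasible_def)
  show ?thesis
  proof (rule cut_lp_tight [OF lp bc_leaves_finite [OF tree] yk])
    fix v assume v: "v \<in> it_leaves A k \<omega>"
    show "qvec D \<omega> \<bullet> it_x A k \<omega> \<le> dual_value D (it_y A k) \<omega> v (it_dual A k \<omega> v)"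
    proof (rule leaf_strong_duality [OF _ assms(2) yk x tree v])
      show "convex_cone (cone2 D)" using assms(1) by (simp add: drp_data_def)
      show "dual_optimal D (it_y A k) \<omega> v (it_dual A k \<omega> v)"
        using it v by (simp add: iteration_def)
    qed (use solved v in \<open>simp add: solved_to_optimality_def\<close>)
  qed
qed

lemma objective_le_upper_candidate:
  assumes "drp_data D" and it: "iteration D A k"
  shows "objective D (it_y A k) \<le> upper_candidate D A k"
proof -
  have "it_p A k \<in> ambiguity D" and "csub_feasible D (it_y A k) \<omega> (it_x A k \<omega>)" for \<omega>
    using it by (auto simp: iteration_def)
  then show ?thesis
    unfolding objective_def upper_candidate_def
    by (intro add_left_mono worst_case_mono [OF assms(1)] Qval_le) auto
qed

lemma master_value_le_objective:
  assumes "drp_data D" and "complete_recourse D" and "strict_recourse D"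
    and it: "\<And>j. 1 \<le> j \<Longrightarrow> j < k \<Longrightarrow> iteration D A j"
    and y: "first_stage_feasible D y"
  shows "master_value D A k \<le> ereal (objective D y)"
proof -
  have "(\<Sum>\<omega>\<in>UNIV. it_p A j $ \<omega> * (it_lam A j \<omega> \<bullet> y + it_zeta A j \<omega>)) \<le> worst_case D (Qval D y)"
    if j: "j \<in> {1..<k}" for j
  proof -
    have p: "it_p A j \<in> ambiguity D" using it j by (auto simp: iteration_def)
    have "(\<Sum>\<omega>\<in>UNIV. it_p A j $ \<omega> * (it_lam A j \<omega> \<bullet> y + it_zeta A j \<omega>))
        \<le> (\<Sum>\<omega>\<in>UNIV. it_p A j $ \<omega> * Qval D y \<omega>)"
      using p assms(1) j
      by (intro sum_mono mult_left_mono scenario_cut_valid assms it y) (auto simp: drp_data_def)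
    also have "\<dots> \<le> worst_case D (Qval D y)" using assms(1) p by (rule le_worst_case)
    finally show ?thesis .
  qed
  \<comment> \<open>The true worst-case value serves as \<eta>, since each aggregated cut uses a
    member of the ambiguity set.\<close>
  then have "master_feasible D A k y (worst_case D (Qval D y))"
    using y by (simp add: master_feasible_def)
  then show ?thesis
    unfolding master_value_def objective_def by (intro Inf_lower) blast
qed

text \<open>The first cut bounds \<eta> below at each of the finitely many \<open>y\<close>, so from
  the second iteration on \<open>master_solution\<close> means true optimality. Inserting 0 keeps
  \<open>Min\<close> defined if there is no feasible \<open>y\<close>.\<close>

lemma master_value_not_MInf:
  assumes "1 < k"
  shows "master_value D A k \<noteq> - \<infinity>"
proof -
  define f where "f y = cost D \<bullet> y
      + (\<Sum>\<omega>\<in>UNIV. it_p A 1 $ \<omega> * (it_lam A 1 \<omega> \<bullet> y + it_zeta A 1 \<omega>))" for y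
  define B where "B = Min (insert 0 (f ` {y. first_stage_feasible D y}))"
  have "ereal B \<le> master_value D A k"
    unfolding master_value_def
  proof (rule Inf_greatest)
    fix z assume "z \<in> {ereal (cost D \<bullet> y + \<eta>) |y \<eta>. master_feasible D A k y \<eta>}"
    then obtain y \<eta> where z: "z = ereal (cost D \<bullet> y + \<eta>)" and "master_feasible D A k y \<eta>"
      by blast
    then have "first_stage_feasible D y" "f y \<le> cost D \<bullet> y + \<eta>"
      using assms by (auto simp: master_feasible_def f_def)
    moreover have "B \<le> f y"
      unfolding B_def using finite_first_stage [of D] calculation(1) by (intro Min_le) auto
    ultimately show "ereal B \<le> z" using z by simp
  qed
  then show ?thesis by auto
qed

section \<open>Incumbents, termination and optimality\<close>

lemma upper_le_candidate:
  assumes "1 \<le> j" and "j \<le> k"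
  shows "upper D A k \<le> ereal (upper_candidate D A j)"
  using assms(2,1)
proof (induction k rule: dec_induct)
  case base
  then show ?case by (cases j) auto
next
  case (step n)
  then show ?case by (auto intro: min.coboundedI1)
qed

lemma best_attains_upper:
  assumes "1 \<le> k"
  obtains j where "1 \<le> j" "j \<le> k" "best D A k = it_y A j" "upper D A k = ereal (upper_candidate D A j)"
proof -
  have "\<exists>j. 1 \<le> j \<and> j \<le> k \<and> best D A k = it_y A j \<and> upper D A k = ereal (upper_candidate D A j)"
    using assms
  proof (induction k)
    case (Suc k)
    show ?case
    proof (cases "ereal (upper_candidate D A (Suc k)) \<le> upper D A k")
      case True
      then show ?thesis by (intro exI [of _ "Suc k"]) (simp add: min_def)
    next
      case False
      \<comment> \<open>The initial upper bound is infinite, so the comparison cannot fail in the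
        first iteration.\<close>
      then have "k \<noteq> 0" by (cases k) auto
      then obtain j where "1 \<le> j" "j \<le> k" "best D A k = it_y A j"
        "upper D A k = ereal (upper_candidate D A j)"
        using Suc.IH by auto
      with False show ?thesis by (intro exI [of _ j]) (simp add: min_def)
    qed
  qed simp
  with that show ?thesis by blast
qed

lemma executed_antimono: "executed D A \<epsilon> k \<Longrightarrow> 1 \<le> j \<Longrightarrow> j \<le> k \<Longrightarrow> executed D A \<epsilon> j"
  by (auto simp: executed_def)

lemma executed_1: "executed D A \<epsilon> 1"
  by (simp add: executed_def lower_def)

text \<open>The master problem at \<open>k\<close> contains the cut of iteration \<open>j\<close>,
  exact at the common iterate. So \<eta> there is at least the worst-case cost recorded at
  \<open>j\<close>, and the master optimum reaches that upper bound.\<close>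

lemma revisit_closes_gap:
  assumes "drp_data D" and "complete_recourse D" and "strict_recourse D"
    and j: "1 \<le> j" "j < k" and rev: "it_y A j = it_y A k"
    and itj: "iteration D A j" and itk: "iteration D A k"
    and solved: "\<And>\<omega>. solved_to_optimality D (it_y A j) \<omega> (it_leaves A j \<omega>) (it_x A j \<omega>)"
  shows "upper D A k \<le> lower D A k"
proof -
  have amb: "ambiguity D \<noteq> {}" and yj: "first_stage_feasible D (it_y A j)"
    using itj by (auto simp: iteration_def master_solution_def master_feasible_def)
  let ?v = "\<lambda>\<omega>. it_lam A j \<omega> \<bullet> it_y A j + it_zeta A j \<omega>"
  have "upper D A k \<le> ereal (upper_candidate D A j)" using j by (intro upper_le_candidate) auto
  also have "upper_candidate D A j \<le> cost D \<bullet> it_y A j + worst_case D ?v"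
    unfolding upper_candidate_def
    by (intro add_left_mono worst_case_mono scenario_cut_tight assms amb)
  also have "worst_case D ?v \<le> (\<Sum>\<omega>\<in>UNIV. it_p A j $ \<omega> * ?v \<omega>)"
    unfolding worst_case_def using itj amb by (intro cSUP_least) (auto simp: iteration_def)
  also have "\<dots> \<le> it_eta A k"
    using itk j rev by (auto simp: iteration_def master_solution_def master_feasible_def)
  also have "ereal (cost D \<bullet> it_y A j + it_eta A k) = lower D A k"
    using itk j rev master_value_not_MInf [of k D A]
    by (auto simp: iteration_def master_solution_def lower_def)
  finally show ?thesis by simp
qed

lemma algorithm_terminates:
  assumes "drp_data D" and "complete_recourse D" and "strict_recourse D" and "0 \<le> \<epsilon>"
    and run: "algorithm_run D A \<epsilon>"
    and solved: "\<And>k \<omega>. N < k \<Longrightarrow> executed D A \<epsilon> k \<Longrightarrow>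
      solved_to_optimality D (it_y A k) \<omega> (it_leaves A k \<omega>) (it_x A k \<omega>)"
  obtains K where "executed D A \<epsilon> K" and "\<not> upper D A K - lower D A K > ereal \<epsilon>"
proof (rule ccontr)
  assume "\<not> thesis"
  with that have gap: "upper D A k - lower D A k > ereal \<epsilon>" if "executed D A \<epsilon> k" for k
    using that by blast
  have exec: "executed D A \<epsilon> (Suc k)" for k
  proof (induction k)
    case 0
    then show ?case using executed_1 by simp
  next
    case (Suc k)
    with gap [OF Suc] show ?case by (auto simp: executed_def less_Suc_eq)
  qed
  then have exec: "executed D A \<epsilon> k" if "1 \<le> k" for k
    using that by (cases k) auto
  have it: "iteration D A k" if "1 \<le> k" for k
    using run exec [OF that] by (auto simp: algorithm_run_def)
  have "it_y A ` {N<..} \<subseteq> {y. first_stage_feasible D y}"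
    using it by (auto simp: iteration_def master_solution_def master_feasible_def Suc_le_eq)
  then have "finite (it_y A ` {N<..})"
    using finite_first_stage finite_subset by blast
  \<comment> \<open>Pigeonhole: infinitely many exactly solved iterations share finitely many
    first-stage points.\<close>
  then have "\<not> inj_on (it_y A) {N<..}"
    using finite_imageD infinite_Ioi by blast
  then obtain i j where "N < i" "N < j" "i \<noteq> j" "it_y A i = it_y A j"
    by (auto simp: inj_on_def)
  then obtain j k where jk: "N < j" "j < k" "it_y A j = it_y A k"
    by (metis nat_neq_iff)
  have "upper D A k \<le> lower D A k"
  proof (rule revisit_closes_gap)
    show "solved_to_optimality D (it_y A j) \<omega> (it_leaves A j \<omega>) (it_x A j \<omega>)" for \<omega>
      using jk by (intro solved exec) auto
  qed (use assms jk it in auto)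
  \<comment> \<open>A finite upper bound rules out a difference of two infinities.\<close>
  moreover obtain r where "upper D A k = ereal r"
    using best_attains_upper [of k D A] jk by auto
  ultimately have "upper D A k - lower D A k \<le> 0"
    by (cases "lower D A k") auto
  moreover have "upper D A k - lower D A k > ereal \<epsilon>" using jk by (intro gap exec) auto
  ultimately show False using \<open>0 \<le> \<epsilon>\<close>
    by (metis ereal_less_eq(5) leD order_trans)
qed

text \<open>A stopping test with tolerance \<epsilon> certifies optimality up to \<epsilon>. It
  becomes exact once \<epsilon> is below every positive difference of objective values, which always
  holds for \<epsilon> = 0.\<close>

theorem theorem3p1:
  fixes D :: "('n::finite, 'f::finite, 'm::finite, 'l::finite, 'w::finite) drp"
    and A :: "('n, 'm, 'l, 'w) run"
    and \<epsilon> :: real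
  assumes "drp_data D"
    and "complete_recourse D"
    and "strict_recourse D"
    and "0 \<le> \<epsilon>"
    and "algorithm_run D A \<epsilon>"
    and "\<exists>N. \<forall>k>N. executed D A \<epsilon> k \<longrightarrow>
           (\<forall>\<omega>. solved_to_optimality D (it_y A k) \<omega> (it_leaves A k \<omega>) (it_x A k \<omega>))"
  shows "\<exists>K y. returns_after D A \<epsilon> K y \<and>
           first_stage_feasible D y \<and>
           (\<forall>y'. first_stage_feasible D y' \<longrightarrow> objective D y \<le> objective D y' + \<epsilon>) \<and>
           ((\<forall>y1 y2. first_stage_feasible D y1 \<and> first_stage_feasible D y2 \<and>
               objective D y1 < objective D y2 \<longrightarrow> \<epsilon> < objective D y2 - objective D y1) \<longrightarrow>
            drp_optimal D y)"
proof -
  obtain K where K: "executed D A \<epsilon> K" "\<not> upper D A K - lower D A K > ereal \<epsilon>"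
    using algorithm_terminates [OF assms(1-5)] assms(6) by metis
  have "1 \<le> K" using K(1) by (simp add: executed_def)
  have it: "iteration D A j" if "1 \<le> j" "j \<le> K" for j
    using assms(5) executed_antimono [OF K(1) that] by (simp add: algorithm_run_def)
  obtain j where j: "1 \<le> j" "j \<le> K" "best D A K = it_y A j"
    "upper D A K = ereal (upper_candidate D A j)"
    using best_attains_upper [OF \<open>1 \<le> K\<close>] by blast
  have feasible: "first_stage_feasible D (it_y A j)"
    using it [OF j(1,2)] by (simp add: iteration_def master_solution_def master_feasible_def)
  \<comment> \<open>The objective at the returned point is at most the final upper bound, hence at
    most \<epsilon> above the lower bound, which no feasible objective undercuts.\<close>
  have near: "objective D (it_y A j) \<le> objective D y + \<epsilon>" if y: "first_stage_feasible D y" for y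
  proof -
    have "objective D (it_y A j) \<le> upper_candidate D A j"
      using assms(1) it [OF j(1,2)] by (rule objective_le_upper_candidate)
    moreover have "lower D A K \<le> ereal (objective D y)"
      using master_value_le_objective [OF assms(1-3) _ y] it \<open>1 \<le> K\<close> by (simp add: lower_def)
    ultimately show ?thesis
      using K(2) j(4) by (cases "lower D A K") auto
  qed
  have "drp_optimal D (it_y A j)"
    if "\<forall>y1 y2. first_stage_feasible D y1 \<and> first_stage_feasible D y2 \<and>
      objective D y1 < objective D y2 \<longrightarrow> \<epsilon> < objective D y2 - objective D y1"
    unfolding drp_optimal_def using feasible near that by (force simp: not_le [symmetric])
  moreover have "returns_after D A \<epsilon> K (it_y A j)"
    using K j(3) by (simp add: returns_after_def)
  ultimately show ?thesis using feasible near by blast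
qed

end
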